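(* Let $\alpha,\gamma,\delta>0$. On the extended Siegel--Jacobi upper half-plane $\tilde{\mathcal{X}}^J_1$ with coordinates $(x,y,p,q,\kappa)$ the metric $$\mathrm{d}s^2_{\tilde{\mathcal{X}}^J_1}=\mathrm{d}s^2_{\mathcal{X}^J_1}(x,y,p,q)+\lambda_6^2(p,q,\kappa)$$ $$=\frac{\alpha}{y^2}(\mathrm{d}x^2+\mathrm{d}y^2)+\Big[\frac\gamma y(x^2+y^2)+\delta q^2\Big]\mathrm{d}p^2+\Big(\frac\gamma y+\delta p^2\Big)\mathrm{d}q^2+\delta\,\mathrm{d}\kappa^2+2\Big(\gamma\frac xy-\delta pq\Big)\mathrm{d}p\,\mathrm{d}q+2\delta(q\,\mathrm{d}p\,\mathrm{d}\kappa-p\,\mathrm{d}q\,\mathrm{d}\kappa)$$ is left-invariant with respect to the action of the Jacobi group $G^J_1(\mathbb{R})$ on $\tilde{\mathcal{X}}^J_1$. Its matrix has nonzero entries (up to symmetry) $g_{xx}=g_{yy}=\frac\alpha{y^2}$, $g'_{pp}=\gamma\frac{x^2+y^2}{y}+\delta q^2$, $g'_{qq}=\frac\gamma y+\delta p^2$, $g'_{pq}=\gamma\frac xy-\delta pq$, $g'_{p\kappa}=\delta q$, $g'_{q\kappa}=-\delta p$, $g'_{\kappa\kappa}=\delta$. The vector fields $L^1_0,L^2_0,L^4,L^5,L^6$ of the context are orthonormal with respect to this metric. The fundamental vector fields of the action, in the variables $(x,y,p,q,\kappa)$, are $$F^*=\partial_x-p\partial_q,\quad G^*=(y^2-x^2)\partial_x-2xy\,\partial_y-q\partial_p,\quad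 H^*=2(x\partial_x+y\partial_y)-p\partial_p+q\partial_q,$$ $$P^*=\partial_p+q\partial_\kappa,\quad Q^*=\partial_q-p\partial_\kappa,\quad R^*=\partial_\kappa.$$ The manifold $\tilde{\mathcal{X}}^J_1$ does not admit an almost contact structure $(\Phi,\xi,\eta)$ in which $\eta=\lambda_6$ is a contact form and $\xi$ is its Reeb vector field.
   Context: The real Jacobi group $G^J_1(\mathbb{R})$ consists of triples $(M,X,\kappa)$, $M=\begin{pmatrix}a&b\\ c&d\end{pmatrix}\in\mathrm{SL}(2,\mathbb{R})$, $X=(\lambda,\mu)\in\mathbb{R}^2$, $\kappa\in\mathbb{R}$, with product $(M,X,\kappa)(M',X',\kappa')=\big(MM',\,XM'+X',\,\kappa+\kappa'+\det\begin{pmatrix}XM'\\ X'\end{pmatrix}\big)$. The manifold $\tilde{\mathcal{X}}^J_1=G^J_1(\mathbb{R})/\mathrm{SO}(2)\cong\{(x,y,p,q,\kappa)\in\mathbb{R}^5:\ y>0\}$ carries the action $(M,X,\kappa)\cdot(x',y',p',q',\kappa')=(x_1,y_1,p_1,q_1,\kappa_1)$ with $x_1+\mathrm{i}y_1=\frac{a\tau'+b}{c\tau'+d}$ ($\tau'=x'+\mathrm{i}y'$), $(p_1,q_1)=\big((\lambda,\mu)+(p',q')\big)M^{-1}$, $\kappa_1=\kappa+\kappa'+\lambda q'-\mu p'$. $\mathrm{d}s^2_{\mathcal{X}^J_1}=\alpha\frac{\mathrm{d}x^2+\mathrm{d}y^2}{y^2}+\frac\gamma y\big[(x^2+y^2)\mathrm{d}p^2+\mathrm{d}q^2+2x\,\mathrm{d}p\,\mathrm{d}q\big]$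 and $\lambda_6=\sqrt\delta\,(\mathrm{d}\kappa-p\,\mathrm{d}q+q\,\mathrm{d}p)$. Vector fields, with $\theta\in\mathbb{R}$ a fixed arbitrary parameter: $L^1_0=\frac{y}{\sqrt\alpha}(\cos2\theta\,\partial_x+\sin2\theta\,\partial_y)$, $L^2_0=\frac y{\sqrt\alpha}(-\sin2\theta\,\partial_x+\cos2\theta\,\partial_y)$, $L^4=\frac1{\sqrt{\gamma y}}\big(\cos\theta\,\partial_p-(x\cos\theta+y\sin\theta)\partial_q-[p(x\cos\theta+y\sin\theta)+q\cos\theta]\partial_\kappa\big)$, $L^5=\frac1{\sqrt{\gamma y}}\big(\sin\theta\,\partial_p+(y\cos\theta-x\sin\theta)\partial_q+[p(y\cos\theta-x\sin\theta)-q\sin\theta]\partial_\kappa\big)$, $L^6=\frac1{\sqrt\delta}\partial_\kappa$. Fundamental vector fields: $Z^*_m=\frac{\mathrm{d}}{\mathrm{d}t}\big|_{t=0}\exp(tZ)\cdot m$, where $\exp(tF),\exp(tG),\exp(tH)$ have $X=0$, $\kappa=0$ and $M=\begin{pmatrix}1&t\\ 0&1\end{pmatrix},\begin{pmatrix}1&0\\ t&1\end{pmatrix},\begin{pmatrix}e^t&0\\ 0&e^{-t}\end{pmatrix}$, and $\exp(tP),\exp(tQ),\exp(tR)$ have $M=1$ and $(\lambda,\mu,\kappa)=(t,0,0),(0,t,0),(0,0,t)$. An almost contact structure $(\Phi,\xi,\eta)$ on a $(2n+1)$-dimensional manifold: a $(1,1)$-tensor $\Phi$, a vector field $\xi$,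 a one-form $\eta$ with $\eta(\xi)=1$, $\Phi^2=-\mathrm{Id}+\xi\otimes\eta$. A one-form $\eta$ is a contact form if $\eta\wedge(\mathrm{d}\eta)^n\neq0$ everywhere. *)

theory Defs
  imports
    "HOL-Analysis.Analysis"
    "HOL-Combinatorics.Permutations"
    "HOL-Algebra.Group"
begin

section \<open>Tensor fields on open subsets of a Euclidean space\<close>

text \<open>
  The manifold of interest is an open subset of a Euclidean space covered by one global chart, so
  every tangent space is identified with the ambient space: a vector field is a map \<open>'a \<Rightarrow> 'a\<close>, a
  one-form is a map \<open>'a \<Rightarrow> 'a \<Rightarrow> real\<close> (point, then tangent vector), and so on. Only the values
  at points of the open set \<open>S\<close> matter.
\<close>

fun Ck_on :: "nat \<Rightarrow> 'a::euclidean_space set \<Rightarrow> ('a \<Rightarrow> 'b::euclidean_space) \<Rightarrow> bool" where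
  "Ck_on 0 S f \<longleftrightarrow> continuous_on S f"
| "Ck_on (Suc k) S f \<longleftrightarrow>
     (\<forall>x\<in>S. f differentiable (at x)) \<and> (\<forall>v. Ck_on k S (\<lambda>x. frechet_derivative f (at x) v))"

definition smooth_on :: "'a::euclidean_space set \<Rightarrow> ('a \<Rightarrow> 'b::euclidean_space) \<Rightarrow> bool" where
  "smooth_on S f \<longleftrightarrow> (\<forall>k. Ck_on k S f)"

definition vector_field :: "'a::euclidean_space set \<Rightarrow> ('a \<Rightarrow> 'a) \<Rightarrow> bool" where
  "vector_field S \<xi> \<longleftrightarrow> smooth_on S \<xi>"

definition one_form :: "'a::euclidean_space set \<Rightarrow> ('a \<Rightarrow> 'a \<Rightarrow> real) \<Rightarrow> bool" where
  "one_form S \<eta> \<longleftrightarrow> (\<forall>m\<in>S. linear (\<eta> m)) \<and> (\<forall>v. smooth_on S (\<lambda>m. \<eta> m v))"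

definition tensor_1_1 :: "'a::euclidean_space set \<Rightarrow> ('a \<Rightarrow> 'a \<Rightarrow> 'a) \<Rightarrow> bool" where
  "tensor_1_1 S \<Phi> \<longleftrightarrow> (\<forall>m\<in>S. linear (\<Phi> m)) \<and> (\<forall>v. smooth_on S (\<lambda>m. \<Phi> m v))"

definition riemannian_metric ::
  "'a::euclidean_space set \<Rightarrow> ('a \<Rightarrow> 'a \<Rightarrow> 'a \<Rightarrow> real) \<Rightarrow> bool" where
  "riemannian_metric S g \<longleftrightarrow>
     (\<forall>m\<in>S. bilinear (g m) \<and> (\<forall>u v. g m u v = g m v u) \<and> (\<forall>v. v \<noteq> 0 \<longrightarrow> g m v v > 0)) \<and>
     (\<forall>u v. smooth_on S (\<lambda>m. g m u v))"

definition invariant_metric ::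
  "'g set \<Rightarrow> ('g \<Rightarrow> 'a \<Rightarrow> 'a) \<Rightarrow> 'a::euclidean_space set \<Rightarrow> ('a \<Rightarrow> 'a \<Rightarrow> 'a \<Rightarrow> real) \<Rightarrow> bool" where
  "invariant_metric G act S g \<longleftrightarrow>
     (\<forall>h\<in>G. \<forall>m\<in>S. act h m \<in> S \<and>
        (\<exists>D. (act h has_derivative D) (at m) \<and> (\<forall>u v. g (act h m) (D u) (D v) = g m u v)))"

definition orthonormal_fields ::
  "'a set \<Rightarrow> ('a \<Rightarrow> 'a \<Rightarrow> 'a \<Rightarrow> real) \<Rightarrow> ('a \<Rightarrow> 'a) list \<Rightarrow> bool" where
  "orthonormal_fields S g Ls \<longleftrightarrow>
     (\<forall>m\<in>S. \<forall>i<length Ls. \<forall>j<length Ls. g m ((Ls ! i) m) ((Ls ! j) m) = (if i = j then 1 else 0))"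

text \<open>Here \<open>e\<close> is the one-parameter subgroup \<open>t \<mapsto> exp (t Z)\<close> and \<open>V\<close> is \<open>Z\<^sup>*\<close>.\<close>

definition fundamental_vector_field ::
  "('g \<Rightarrow> 'a \<Rightarrow> 'a) \<Rightarrow> 'a::euclidean_space set \<Rightarrow> (real \<Rightarrow> 'g) \<Rightarrow> ('a \<Rightarrow> 'a) \<Rightarrow> bool" where
  "fundamental_vector_field act S e V \<longleftrightarrow>
     (\<forall>m\<in>S. ((\<lambda>t. act (e t) m) has_vector_derivative V m) (at 0))"


section \<open>Contact forms and almost contact structures\<close>

text \<open>
  A \<open>k\<close>-form at a point is a function of a sequence of tangent vectors that uses only the entries
  \<open>0, \<dots>, k - 1\<close>; the degrees are passed explicitly to the wedge product.
\<close>

type_synonym 'a form = "(nat \<Rightarrow> 'a) \<Rightarrow> real"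

definition wedge :: "nat \<Rightarrow> nat \<Rightarrow> 'a form \<Rightarrow> 'a form \<Rightarrow> 'a form" where
  "wedge k l \<omega> \<zeta> vs =
     (\<Sum>\<sigma> | \<sigma> permutes {..<k + l}.
        of_int (sign \<sigma>) * \<omega> (\<lambda>i. vs (\<sigma> i)) * \<zeta> (\<lambda>i. vs (\<sigma> (k + i)))) / (fact k * fact l)"

fun wedge_power :: "nat \<Rightarrow> 'a form \<Rightarrow> nat \<Rightarrow> 'a form" where
  "wedge_power k \<omega> 0 = (\<lambda>vs. 1)"
| "wedge_power k \<omega> (Suc n) = wedge k (k * n) \<omega> (wedge_power k \<omega> n)"

text \<open>
  For constant vector fields \<open>u\<close>, \<open>v\<close> one has \<open>[u, v] = 0\<close>, so that
  \<open>d\<eta>(u, v) = u (\<eta>(v)) - v (\<eta>(u)) - \<eta>([u, v])\<close> reduces to the following. (The convention with an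
  additional factor \<open>1/2\<close> leads to the same contact forms and Reeb fields.)
\<close>

definition ext_deriv ::
  "('a::euclidean_space \<Rightarrow> 'a \<Rightarrow> real) \<Rightarrow> 'a \<Rightarrow> 'a \<Rightarrow> 'a \<Rightarrow> real" where
  "ext_deriv \<eta> m u v =
     frechet_derivative (\<lambda>m. \<eta> m v) (at m) u - frechet_derivative (\<lambda>m. \<eta> m u) (at m) v"

definition contact_form :: "'a::euclidean_space set \<Rightarrow> ('a \<Rightarrow> 'a \<Rightarrow> real) \<Rightarrow> bool" where
  "contact_form S \<eta> \<longleftrightarrow> one_form S \<eta> \<and>
     (\<exists>n. DIM('a) = 2 * n + 1 \<and>
       (\<forall>m\<in>S. wedge 1 (2 * n) (\<lambda>vs. \<eta> m (vs 0))
                 (wedge_power 2 (\<lambda>vs. ext_deriv \<eta> m (vs 0) (vs 1)) n) \<noteq> (\<lambda>vs. 0)))"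

definition reeb_vector_field ::
  "'a::euclidean_space set \<Rightarrow> ('a \<Rightarrow> 'a \<Rightarrow> real) \<Rightarrow> ('a \<Rightarrow> 'a) \<Rightarrow> bool" where
  "reeb_vector_field S \<eta> \<xi> \<longleftrightarrow> vector_field S \<xi> \<and>
     (\<forall>m\<in>S. \<eta> m (\<xi> m) = 1 \<and> (\<forall>v. ext_deriv \<eta> m (\<xi> m) v = 0))"

definition almost_contact_structure ::
  "'a::euclidean_space set \<Rightarrow> ('a \<Rightarrow> 'a \<Rightarrow> 'a) \<Rightarrow> ('a \<Rightarrow> 'a) \<Rightarrow> ('a \<Rightarrow> 'a \<Rightarrow> real) \<Rightarrow> bool" where
  "almost_contact_structure S \<Phi> \<xi> \<eta> \<longleftrightarrow> odd (DIM('a)) \<and>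
     tensor_1_1 S \<Phi> \<and> vector_field S \<xi> \<and> one_form S \<eta> \<and>
     (\<forall>m\<in>S. \<eta> m (\<xi> m) = 1 \<and> (\<forall>v. \<Phi> m (\<Phi> m v) = - v + \<eta> m v *\<^sub>R \<xi> m))"


section \<open>The real Jacobi group and its action\<close>

type_synonym jac = "(real^2^2) \<times> (real^2) \<times> real"

text \<open>\<open>vector [u, v]\<close> with \<open>u v :: real^2\<close> is the matrix with rows \<open>u\<close> and \<open>v\<close>.\<close>

definition jacobi_group :: "jac monoid" where
  "jacobi_group = \<lparr>
     carrier = {(M, X, \<kappa>). det M = 1},
     mult = (\<lambda>(M, X, \<kappa>) (M', X', \<kappa>').
       (M ** M', X v* M' + X', \<kappa> + \<kappa>' + det (vector [X v* M', X'] :: real^2^2))),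
     one = (mat 1, 0, 0)\<rparr>"

type_synonym pt4 = "real \<times> real \<times> real \<times> real"
type_synonym pt5 = "real \<times> real \<times> real \<times> real \<times> real"

text \<open>Both points and tangent vectors are written in the coordinates \<open>(x, y, p, q, \<kappa>)\<close>.\<close>

definition ext_SJ :: "pt5 set" where
  "ext_SJ = {(x, y, p, q, \<kappa>). y > 0}"

definition jac_act :: "jac \<Rightarrow> pt5 \<Rightarrow> pt5" where
  "jac_act = (\<lambda>(M, X, \<kappa>) (x', y', p', q', \<kappa>').
     let \<tau>' = Complex x' y';
         \<tau> = (of_real (M$1$1) * \<tau>' + of_real (M$1$2)) / (of_real (M$2$1) * \<tau>' + of_real (M$2$2));
         w = (X + vector [p', q']) v* matrix_inv M
     in (Re \<tau>, Im \<tau>, w$1, w$2, \<kappa> + \<kappa>' + X$1 * q' - X$2 * p'))"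

definition exp_F :: "real \<Rightarrow> jac" where "exp_F t = (vector [vector [1, t], vector [0, 1]], 0, 0)"
definition exp_G :: "real \<Rightarrow> jac" where "exp_G t = (vector [vector [1, 0], vector [t, 1]], 0, 0)"
definition exp_H :: "real \<Rightarrow> jac" where
  "exp_H t = (vector [vector [exp t, 0], vector [0, exp (- t)]], 0, 0)"
definition exp_P :: "real \<Rightarrow> jac" where "exp_P t = (mat 1, vector [t, 0], 0)"
definition exp_Q :: "real \<Rightarrow> jac" where "exp_Q t = (mat 1, vector [0, t], 0)"
definition exp_R :: "real \<Rightarrow> jac" where "exp_R t = (mat 1, 0, t)"


section \<open>The metric and the frame\<close>

text \<open>
  The symmetric bilinear form obtained by polarization from the quadratic form
  \<open>\<alpha> (dx\<^sup>2 + dy\<^sup>2) / y\<^sup>2 + \<gamma> / y [(x\<^sup>2 + y\<^sup>2) dp\<^sup>2 + dq\<^sup>2 + 2 x dp dq]\<close> on the Siegel-Jacobi upper half-plane.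
\<close>

fun SJ_metric :: "real \<Rightarrow> real \<Rightarrow> pt4 \<Rightarrow> pt4 \<Rightarrow> pt4 \<Rightarrow> real" where
  "SJ_metric \<alpha> \<gamma> (x, y, p, q) (dx, dy, dp, dq) (dx', dy', dp', dq') =
     \<alpha> * (dx * dx' + dy * dy') / y\<^sup>2
     + \<gamma> / y * ((x\<^sup>2 + y\<^sup>2) * (dp * dp') + dq * dq' + x * (dp * dq' + dq * dp'))"

fun lambda6 :: "real \<Rightarrow> pt5 \<Rightarrow> pt5 \<Rightarrow> real" where
  "lambda6 \<delta> (x, y, p, q, \<kappa>) (dx, dy, dp, dq, d\<kappa>) = sqrt \<delta> * (d\<kappa> - p * dq + q * dp)"

fun ext_metric :: "real \<Rightarrow> real \<Rightarrow> real \<Rightarrow> pt5 \<Rightarrow> pt5 \<Rightarrow> pt5 \<Rightarrow> real" where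
  "ext_metric \<alpha> \<gamma> \<delta> (x, y, p, q, \<kappa>) (dx, dy, dp, dq, d\<kappa>) (dx', dy', dp', dq', d\<kappa>') =
     SJ_metric \<alpha> \<gamma> (x, y, p, q) (dx, dy, dp, dq) (dx', dy', dp', dq')
     + lambda6 \<delta> (x, y, p, q, \<kappa>) (dx, dy, dp, dq, d\<kappa>)
       * lambda6 \<delta> (x, y, p, q, \<kappa>) (dx', dy', dp', dq', d\<kappa>')"

definition coord_fields :: "pt5 list" where
  "coord_fields =
     [(1, 0, 0, 0, 0), (0, 1, 0, 0, 0), (0, 0, 1, 0, 0), (0, 0, 0, 1, 0), (0, 0, 0, 0, 1)]"

text \<open>The matrix, as the list of its rows, of a bilinear form in the frame
  \<open>\<partial>\<^sub>x, \<partial>\<^sub>y, \<partial>\<^sub>p, \<partial>\<^sub>q, \<partial>\<^sub>\<kappa>\<close>.\<close>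

definition metric_matrix :: "(pt5 \<Rightarrow> pt5 \<Rightarrow> real) \<Rightarrow> real list list" where
  "metric_matrix b = map (\<lambda>u. map (b u) coord_fields) coord_fields"

fun L1_0 :: "real \<Rightarrow> real \<Rightarrow> pt5 \<Rightarrow> pt5" where
  "L1_0 \<alpha> \<theta> (x, y, p, q, \<kappa>) = (y / sqrt \<alpha>) *\<^sub>R (cos (2 * \<theta>), sin (2 * \<theta>), 0, 0, 0)"

fun L2_0 :: "real \<Rightarrow> real \<Rightarrow> pt5 \<Rightarrow> pt5" where
  "L2_0 \<alpha> \<theta> (x, y, p, q, \<kappa>) = (y / sqrt \<alpha>) *\<^sub>R (- sin (2 * \<theta>), cos (2 * \<theta>), 0, 0, 0)"

fun L4 :: "real \<Rightarrow> real \<Rightarrow> pt5 \<Rightarrow> pt5" where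
  "L4 \<gamma> \<theta> (x, y, p, q, \<kappa>) = (1 / sqrt (\<gamma> * y)) *\<^sub>R
     (0, 0, cos \<theta>, - (x * cos \<theta> + y * sin \<theta>),
      - (p * (x * cos \<theta> + y * sin \<theta>) + q * cos \<theta>))"

fun L5 :: "real \<Rightarrow> real \<Rightarrow> pt5 \<Rightarrow> pt5" where
  "L5 \<gamma> \<theta> (x, y, p, q, \<kappa>) = (1 / sqrt (\<gamma> * y)) *\<^sub>R
     (0, 0, sin \<theta>, y * cos \<theta> - x * sin \<theta>,
      p * (y * cos \<theta> - x * sin \<theta>) - q * sin \<theta>)"

fun L6 :: "real \<Rightarrow> pt5 \<Rightarrow> pt5" where
  "L6 \<delta> (x, y, p, q, \<kappa>) = (1 / sqrt \<delta>) *\<^sub>R (0, 0, 0, 0, 1)"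

end

theory Submission
  imports Defs
begin

text \<open>
  With \<open>\<tau> = x + \<i> y\<close> the metric is the sum of squares
  \<open>\<alpha> |d\<tau>|\<^sup>2 / (Im \<tau>)\<^sup>2 + \<gamma> |\<tau> dp + dq|\<^sup>2 / Im \<tau> + \<lambda>\<^sub>6\<^sup>2\<close> (lemma \<open>ext_metric_eq\<close>), and all metric claims are
  read off from this form. It is positive definite because \<open>d\<tau>\<close>, \<open>\<tau> dp + dq\<close> and \<open>\<lambda>\<^sub>6\<close> have no common
  zero when \<open>Im \<tau> > 0\<close>. The frame is orthonormal because these three forms take on it only the values
  \<open>0\<close>, \<open>1\<close> and positive multiples of \<open>e\<^sup>i\<^sup>t\<close> and \<open>\<i> e\<^sup>i\<^sup>t\<close>.

  For the invariance let \<open>j = c \<tau> + d\<close> be the automorphy factor of a matrix with rows \<open>(a, b)\<close> and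
  \<open>(c, d)\<close> of determinant one. The action turns \<open>Im \<tau>\<close> into \<open>Im \<tau> / |j|\<^sup>2\<close>, \<open>d\<tau>\<close> into \<open>d\<tau> / j\<^sup>2\<close> and
  \<open>\<tau> dp + dq\<close> into \<open>(\<tau> dp + dq) / j\<close>, so the powers of \<open>|j|\<close> cancel in the first two squares. The form
  \<open>\<lambda>\<^sub>6\<close> is itself invariant: \<open>p dq - q dp\<close> is the symplectic pairing of \<open>(p, q)\<close> with \<open>(dp, dq)\<close>, which a
  matrix of determinant one preserves, and the change that a translation of \<open>(p, q)\<close> by \<open>(\<lambda>, \<mu>)\<close> causes
  in it is the differential of the term \<open>\<lambda> q - \<mu> p\<close> that the action adds to \<open>\<kappa>\<close>.

  The nonexistence claim holds because \<open>\<lambda>\<^sub>6\<close> is not a contact form. A contact form in dimension five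
  needs \<open>\<eta> \<and> d\<eta> \<and> d\<eta> \<noteq> 0\<close>, but \<open>d\<lambda>\<^sub>6\<close> is a multiple of \<open>dq \<and> dp\<close>, and a decomposable two-form has
  square zero (lemma \<open>wedge_decomposable_self\<close>).
\<close>

section \<open>Smoothness of algebraic expressions\<close>

lemma Ck_on_cong:
  assumes "open S" and "\<And>x. x \<in> S \<Longrightarrow> f x = g x" and "Ck_on k S f"
  shows "Ck_on k S g"
  using assms(2,3)
proof (induction k arbitrary: f g)
  case 0
  then show ?case
    using continuous_on_cong by force
next
  case (Suc k)
  have der: "(g has_derivative frechet_derivative f (at x)) (at x)" if "x \<in> S" for x
  proof (rule has_derivative_transform_within_open[OF _ assms(1) that Suc.prems(1)])
    show "(f has_derivative frechet_derivative f (at x)) (at x)"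
      using that Suc.prems by (simp add: frechet_derivative_works)
  qed
  have "Ck_on k S (\<lambda>x. frechet_derivative g (at x) v)" for v
  proof (rule Suc.IH)
    show "Ck_on k S (\<lambda>x. frechet_derivative f (at x) v)"
      using Suc.prems by simp
    show "frechet_derivative f (at x) v = frechet_derivative g (at x) v" if "x \<in> S" for x
      using frechet_derivative_at[OF der[OF that]] by simp
  qed
  then show ?case
    using der by (auto simp: differentiable_def)
qed

text \<open>
  The recursive definition speaks of the Frechet derivative chosen by a description operator. This rule
  replaces it by any known derivative, so that closure properties follow from the rules of
  differentiation by induction on the order.
\<close>

lemma Ck_on_SucI:
  assumes "open S" and der: "\<And>x. x \<in> S \<Longrightarrow> (f has_derivative f' x) (at x)"
    and "\<And>v. Ck_on k S (\<lambda>x. f' x v)"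
  shows "Ck_on (Suc k) S f"
proof -
  have "Ck_on k S (\<lambda>x. frechet_derivative f (at x) v)" for v
    using Ck_on_cong[OF assms(1) _ assms(3)] frechet_derivative_at[OF der] by simp
  then show ?thesis
    using der by (auto simp: differentiable_def)
qed

text \<open>
  The product and the reciprocal reappear undifferentiated in their own derivatives, so their induction
  steps need the functions at the lower order as well.
\<close>

lemma Ck_on_SucD: "Ck_on (Suc k) S f \<Longrightarrow> Ck_on k S f"
proof (induction k arbitrary: f)
  case 0
  then show ?case
    by (auto intro!: continuous_at_imp_continuous_on differentiable_imp_continuous_within)
qed simp

lemma Ck_on_Suc_has_derivative:
  "Ck_on (Suc k) S f \<Longrightarrow> x \<in> S \<Longrightarrow> (f has_derivative frechet_derivative f (at x)) (at x)"
  by (simp add: frechet_derivative_works)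

lemma Ck_on_const: "open S \<Longrightarrow> Ck_on k S (\<lambda>x. c)"
proof (induction k arbitrary: c)
  case (Suc k)
  show ?case
    by (rule Ck_on_SucI[where f' = "\<lambda>_ _. 0"]) (use Suc in auto)
qed simp

lemma Ck_on_bounded_linear:
  assumes "open S" and "bounded_linear f"
  shows "Ck_on k S f"
proof (cases k)
  case 0
  then show ?thesis
    using assms(2) by (simp add: linear_continuous_on)
next
  case (Suc n)
  then show ?thesis
    using assms Ck_on_SucI[OF assms(1) bounded_linear_imp_has_derivative[OF assms(2)]] Ck_on_const
    by blast
qed

lemma Ck_on_add:
  assumes "open S" "Ck_on k S f" "Ck_on k S g"
  shows "Ck_on k S (\<lambda>x. f x + g x)"
  using assms(2,3)
proof (induction k arbitrary: f g)
  case (Suc k)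
  show ?case
    by (rule Ck_on_SucI[OF assms(1) has_derivative_add[OF Suc.prems[THEN Ck_on_Suc_has_derivative]]])
      (use Suc in auto)
qed (simp add: continuous_on_add)

lemma Ck_on_mult:
  fixes f g :: "'a::euclidean_space \<Rightarrow> real"
  assumes "open S" "Ck_on k S f" "Ck_on k S g"
  shows "Ck_on k S (\<lambda>x. f x * g x)"
  using assms(2,3)
proof (induction k arbitrary: f g)
  case (Suc k)
  note Ck = Suc.prems[THEN Ck_on_SucD]
  show ?case
    by (rule Ck_on_SucI[OF assms(1) has_derivative_mult[OF Suc.prems[THEN Ck_on_Suc_has_derivative]]])
      (use Suc Ck in \<open>auto intro!: Ck_on_add[OF assms(1)]\<close>)
qed (simp add: continuous_on_mult)

lemma Ck_on_inverse:
  fixes f :: "'a::euclidean_space \<Rightarrow> real"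
  assumes "open S" "Ck_on k S f" "\<And>x. x \<in> S \<Longrightarrow> f x \<noteq> 0"
  shows "Ck_on k S (\<lambda>x. inverse (f x))"
  using assms(2)
proof (induction k)
  case (Suc k)
  have inv: "Ck_on k S (\<lambda>x. inverse (f x))"
    using Suc Ck_on_SucD by blast
  have "Ck_on k S (\<lambda>x. (- 1) * (inverse (f x) * frechet_derivative f (at x) v * inverse (f x)))" for v
    by (intro Ck_on_mult Ck_on_const assms(1) inv) (use Suc in auto)
  then show ?case
    by (intro Ck_on_SucI[OF assms(1) Deriv.has_derivative_inverse[OF assms(3)
            Suc.prems[THEN Ck_on_Suc_has_derivative]]]) auto
qed (use assms(3) in \<open>simp add: continuous_on_inverse\<close>)

lemma smooth_on_const: "open S \<Longrightarrow> smooth_on S (\<lambda>x. c)"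
  by (simp add: smooth_on_def Ck_on_const)

lemma smooth_on_bounded_linear: "open S \<Longrightarrow> bounded_linear f \<Longrightarrow> smooth_on S f"
  by (simp add: smooth_on_def Ck_on_bounded_linear)

lemma smooth_on_add:
  "open S \<Longrightarrow> smooth_on S f \<Longrightarrow> smooth_on S g \<Longrightarrow> smooth_on S (\<lambda>x. f x + g x)"
  by (simp add: smooth_on_def Ck_on_add)

lemma smooth_on_mult:
  fixes f g :: "'a::euclidean_space \<Rightarrow> real"
  shows "open S \<Longrightarrow> smooth_on S f \<Longrightarrow> smooth_on S g \<Longrightarrow> smooth_on S (\<lambda>x. f x * g x)"
  by (simp add: smooth_on_def Ck_on_mult)

lemma smooth_on_inverse:
  fixes f :: "'a::euclidean_space \<Rightarrow> real"
  shows "open S \<Longrightarrow> smooth_on S f \<Longrightarrow> (\<And>x. x \<in> S \<Longrightarrow> f x \<noteq> 0) \<Longrightarrow> smooth_on S (\<lambda>x. inverse (f x))"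
  by (simp add: smooth_on_def Ck_on_inverse)

section \<open>Decomposable two-forms\<close>

text \<open>
  Composition with the transposition reverses all signs, hence the sum equals its own negative.
\<close>

lemma sum_sign_eq_0_if_transposition_invariant:
  fixes h :: "(nat \<Rightarrow> nat) \<Rightarrow> real"
  assumes "finite S" "i \<in> S" "j \<in> S" "i \<noteq> j"
    and inv: "\<And>\<sigma>. h (\<sigma> \<circ> Transposition.transpose i j) = h \<sigma>"
  shows "(\<Sum>\<sigma> | \<sigma> permutes S. of_int (sign \<sigma>) * h \<sigma>) = 0"
proof -
  let ?s = "\<Sum>\<sigma> | \<sigma> permutes S. of_int (sign \<sigma>) * h \<sigma>"
  have t: "Transposition.transpose i j permutes S"
    using assms(2,3) by (rule permutes_swap_id)
  have "?s = (\<Sum>\<sigma> | \<sigma> permutes S. of_int (sign (\<sigma> \<circ> Transposition.transpose i j)) * h (\<sigma> \<circ> Transposition.transpose i j))"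
    by (rule sum_permutations_compose_right[OF t])
  also have "\<dots> = (\<Sum>\<sigma> | \<sigma> permutes S. - (of_int (sign \<sigma>) * h \<sigma>))"
  proof (rule sum.cong[OF refl])
    fix \<sigma> assume "\<sigma> \<in> {\<sigma>. \<sigma> permutes S}"
    then have "permutation \<sigma>"
      using assms(1) permutes_imp_permutation by blast
    then have "sign (\<sigma> \<circ> Transposition.transpose i j) = - sign \<sigma>"
      using assms(4) by (simp add: sign_compose permutation_swap_id sign_swap_id)
    then show "of_int (sign (\<sigma> \<circ> Transposition.transpose i j)) * h (\<sigma> \<circ> Transposition.transpose i j) = - (of_int (sign \<sigma>) * h \<sigma>)"
      using inv by simp
  qed
  finally show ?thesis
    by (simp add: sum_negf)
qed

text \<open>
  The powers of a form start from the constant zero-form \<open>1\<close>, so this identifies the first power of an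
  alternating two-form with the form itself.
\<close>

lemma wedge_2_0_one:
  fixes \<omega> :: "'a form"
  assumes alt: "\<And>vs. \<omega> (\<lambda>i. vs (Transposition.transpose 0 1 i)) = - \<omega> vs"
  shows "wedge 2 0 \<omega> (\<lambda>vs. 1) = \<omega>"
proof
  fix vs
  have "{..<2 + 0} = {0::nat, 1}" by auto
  moreover have "{\<sigma>. \<sigma> permutes {0::nat, 1}} = {id, Transposition.transpose 0 1}"
    by (auto simp: permutes_doubleton_iff)
  moreover have "id \<noteq> Transposition.transpose (0::nat) 1"
    by (metis id_apply transpose_apply_first zero_neq_one)
  ultimately show "wedge 2 0 \<omega> (\<lambda>vs. 1) vs = \<omega> vs"
    using alt[of vs] by (simp add: wedge_def sign_swap_id sign_id del: One_nat_def)
qed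

text \<open>
  Expanding \<open>(a \<and> b) \<and> (a \<and> b)\<close> gives four alternating sums. In each of them \<open>a\<close> is applied to two
  different arguments, whose exchange leaves the summand unchanged, so each sum vanishes.
\<close>

lemma wedge_decomposable_self:
  fixes a b :: "'a \<Rightarrow> real"
  assumes \<omega>: "\<And>vs. \<omega> vs = a (vs 0) * b (vs 1) - a (vs 1) * b (vs 0)"
  shows "wedge 2 2 \<omega> \<omega> = (\<lambda>vs. 0)"
proof
  fix vs :: "nat \<Rightarrow> 'a"
  have four: "{..<2 + 2} = {..<4::nat}" by simp
  define A B where "A i = (\<lambda>\<sigma>. a (vs (\<sigma> i)))" and "B i = (\<lambda>\<sigma>. b (vs (\<sigma> i)))"
    for i :: nat
  have zero: "(\<Sum>\<sigma> | \<sigma> permutes {..<4}. of_int (sign \<sigma>) * (A i \<sigma> * B j \<sigma> * A k \<sigma> * B l \<sigma>)) = 0"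
    if "i < 4" "k < 4" "i \<noteq> k" "{j, l} \<inter> {i, k} = {}" for i j k l
  proof (rule sum_sign_eq_0_if_transposition_invariant)
    fix \<sigma> :: "nat \<Rightarrow> nat"
    let ?\<tau> = "\<sigma> \<circ> Transposition.transpose i k"
    have "A i ?\<tau> = A k \<sigma>" "A k ?\<tau> = A i \<sigma>" "B j ?\<tau> = B j \<sigma>" "B l ?\<tau> = B l \<sigma>"
      using that(4) by (auto simp: A_def B_def transpose_apply_other)
    then show "A i ?\<tau> * B j ?\<tau> * A k ?\<tau> * B l ?\<tau> = A i \<sigma> * B j \<sigma> * A k \<sigma> * B l \<sigma>"
      by (simp only: ac_simps)
  qed (use that in auto)
  have terms: "of_int (sign \<sigma>) * \<omega> (\<lambda>i. vs (\<sigma> i)) * \<omega> (\<lambda>i. vs (\<sigma> (2 + i))) =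
      of_int (sign \<sigma>) * (A 0 \<sigma> * B 1 \<sigma> * A 2 \<sigma> * B 3 \<sigma>)
      - of_int (sign \<sigma>) * (A 0 \<sigma> * B 1 \<sigma> * A 3 \<sigma> * B 2 \<sigma>)
      - of_int (sign \<sigma>) * (A 1 \<sigma> * B 0 \<sigma> * A 2 \<sigma> * B 3 \<sigma>)
      + of_int (sign \<sigma>) * (A 1 \<sigma> * B 0 \<sigma> * A 3 \<sigma> * B 2 \<sigma>)" for \<sigma>
  proof -
    have idx: "2 + (0::nat) = 2" "2 + (1::nat) = 3" by simp_all
    show ?thesis
      unfolding \<omega> A_def B_def idx by algebra
  qed
  have zeros:
    "(\<Sum>\<sigma> | \<sigma> permutes {..<4}. of_int (sign \<sigma>) * (A 0 \<sigma> * B 1 \<sigma> * A 2 \<sigma> * B 3 \<sigma>)) = 0"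
    "(\<Sum>\<sigma> | \<sigma> permutes {..<4}. of_int (sign \<sigma>) * (A 0 \<sigma> * B 1 \<sigma> * A 3 \<sigma> * B 2 \<sigma>)) = 0"
    "(\<Sum>\<sigma> | \<sigma> permutes {..<4}. of_int (sign \<sigma>) * (A 1 \<sigma> * B 0 \<sigma> * A 2 \<sigma> * B 3 \<sigma>)) = 0"
    "(\<Sum>\<sigma> | \<sigma> permutes {..<4}. of_int (sign \<sigma>) * (A 1 \<sigma> * B 0 \<sigma> * A 3 \<sigma> * B 2 \<sigma>)) = 0"
    by (rule zero; simp)+
  show "wedge 2 2 \<omega> \<omega> vs = 0"
    unfolding wedge_def four terms sum.distrib sum_subtractf zeros by simp
qed

lemma wedge_zero_right: "wedge k l \<omega> (\<lambda>vs. 0) = (\<lambda>vs. 0)"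
  by (simp add: wedge_def fun_eq_iff)

text \<open>
  In dimension five the contact condition asks at every point for a nonzero square of the exterior
  derivative, so one point where that derivative is decomposable violates it.
\<close>

lemma not_contact_form_if_decomposable:
  fixes \<eta> :: "'a::euclidean_space \<Rightarrow> 'a \<Rightarrow> real"
  assumes "DIM('a) = 5" and "m \<in> S"
    and "\<And>u v. ext_deriv \<eta> m u v = a u * b v - a v * b u"
  shows "\<not> contact_form S \<eta>"
proof
  assume "contact_form S \<eta>"
  then obtain n where n: "DIM('a) = 2 * n + 1" and
    ne: "wedge 1 (2 * n) (\<lambda>vs. \<eta> m (vs 0))
           (wedge_power 2 (\<lambda>vs. ext_deriv \<eta> m (vs 0) (vs 1)) n) \<noteq> (\<lambda>vs. 0)"
    using assms(2) unfolding contact_form_def by blast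
  have "n = Suc (Suc 0)" using n assms(1) by simp
  let ?\<omega> = "\<lambda>vs. ext_deriv \<eta> m (vs 0) (vs 1)"
  have "wedge 2 0 ?\<omega> (\<lambda>vs. 1) = ?\<omega>"
    by (rule wedge_2_0_one) (simp add: assms(3))
  moreover have "wedge 2 2 ?\<omega> ?\<omega> = (\<lambda>vs. 0)"
    by (rule wedge_decomposable_self[where a = a and b = b]) (simp add: assms(3))
  ultimately have "wedge_power 2 ?\<omega> n = (\<lambda>vs. 0)"
    by (simp only: \<open>n = _\<close> wedge_power.simps mult_0_right mult_Suc_right add_0_right)
  then show False
    using ne by (simp only: wedge_zero_right not_True_eq_False simp_thms)
qed

section \<open>The metric in complex notation\<close>

text \<open>
  Each coordinate serves two purposes: applied to a point it is \<open>\<tau>\<close>, \<open>p\<close>, \<open>q\<close> or \<open>\<kappa>\<close>, and applied to a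
  tangent vector it is \<open>d\<tau>\<close>, \<open>dp\<close>, \<open>dq\<close> or \<open>d\<kappa>\<close>.
\<close>

definition tau :: "pt5 \<Rightarrow> complex" where "tau m = Complex (fst m) (fst (snd m))"
definition p_of :: "pt5 \<Rightarrow> real" where "p_of m = fst (snd (snd m))"
definition q_of :: "pt5 \<Rightarrow> real" where "q_of m = fst (snd (snd (snd m)))"
definition kappa_of :: "pt5 \<Rightarrow> real" where "kappa_of m = snd (snd (snd (snd m)))"

lemma coord_simps [simp]:
  "tau (x, y, p, q, k) = Complex x y" "p_of (x, y, p, q, k) = p" "q_of (x, y, p, q, k) = q"
  "kappa_of (x, y, p, q, k) = k"
  by (simp_all add: tau_def p_of_def q_of_def kappa_of_def)

lemma bounded_linear_tau: "bounded_linear tau"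
  unfolding tau_def Complex_eq
  by (intro bounded_linear_intros bounded_linear_compose[OF bounded_linear_of_real] bounded_linear_fst)

lemma bounded_linear_p_of: "bounded_linear p_of"
  unfolding p_of_def by (intro bounded_linear_intros)

lemma bounded_linear_q_of: "bounded_linear q_of"
  unfolding q_of_def by (intro bounded_linear_intros)

lemma bounded_linear_kappa_of: "bounded_linear kappa_of"
  unfolding kappa_of_def by (intro bounded_linear_intros)

lemma mem_ext_SJ: "m \<in> ext_SJ \<longleftrightarrow> Im (tau m) > 0"
  by (cases m) (auto simp: ext_SJ_def)

lemma open_ext_SJ: "open ext_SJ"
proof -
  have "ext_SJ = {m. 0 < Im (tau m)}"
    using mem_ext_SJ by blast
  moreover have "open {m. 0 < Im (tau m)}"
    by (intro open_Collect_less continuous_on_const continuous_on_Im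
        bounded_linear.continuous_on[OF bounded_linear_tau continuous_on_id])
  ultimately show ?thesis
    by simp
qed

text \<open>
  The one-form \<open>\<tau> dp + dq\<close>, which is the differential of \<open>p \<tau> + q\<close> along the fibres over the upper
  half-plane.
\<close>

definition tau_dp_dq :: "pt5 \<Rightarrow> pt5 \<Rightarrow> complex" where
  "tau_dp_dq m u = of_real (p_of u) * tau m + of_real (q_of u)"

lemma lambda6_eq: "lambda6 \<delta> m u = sqrt \<delta> * (kappa_of u - p_of m * q_of u + q_of m * p_of u)"
  by (cases m; cases u) simp

lemma ext_metric_eq:
  "ext_metric \<alpha> \<gamma> \<delta> m u v =
     \<alpha> / (Im (tau m))\<^sup>2 * Re (tau u * cnj (tau v))
     + \<gamma> / Im (tau m) * Re (tau_dp_dq m u * cnj (tau_dp_dq m v))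
     + lambda6 \<delta> m u * lambda6 \<delta> m v"
  by (cases m; cases u; cases v) (simp add: tau_dp_dq_def algebra_simps add_divide_distrib power2_eq_square)

lemma linear_lambda6: "linear (lambda6 \<delta> m)"
  by (rule linearI) (simp_all add: lambda6_eq bounded_linear.linear[OF bounded_linear_p_of, THEN linear_add]
      bounded_linear.linear[OF bounded_linear_q_of, THEN linear_add]
      bounded_linear.linear[OF bounded_linear_kappa_of, THEN linear_add]
      bounded_linear.linear[OF bounded_linear_p_of, THEN linear_scale]
      bounded_linear.linear[OF bounded_linear_q_of, THEN linear_scale]
      bounded_linear.linear[OF bounded_linear_kappa_of, THEN linear_scale] algebra_simps)

lemma ext_metric_sym: "ext_metric \<alpha> \<gamma> \<delta> m u v = ext_metric \<alpha> \<gamma> \<delta> m v u"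
  by (simp add: ext_metric_eq algebra_simps)

lemma linear_ext_metric: "linear (ext_metric \<alpha> \<gamma> \<delta> m u)"
proof -
  have "linear (\<lambda>v. \<alpha> / (Im (tau m))\<^sup>2 * Re (tau u * cnj (tau v))
     + \<gamma> / Im (tau m) * Re (tau_dp_dq m u * cnj (tau_dp_dq m v))
     + lambda6 \<delta> m u * lambda6 \<delta> m v)"
    unfolding tau_dp_dq_def
    by (intro bounded_linear.linear bounded_linear_intros
        linear_lambda6[unfolded linear_conv_bounded_linear]
        bounded_linear_compose[OF bounded_linear_Re] bounded_linear_compose[OF bounded_linear_of_real]
        bounded_linear_compose[OF bounded_linear_cnj]
        bounded_linear_tau bounded_linear_p_of bounded_linear_q_of)
  then show ?thesis
    by (simp add: ext_metric_eq[abs_def])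
qed

text \<open>
  If all three squares vanish at \<open>v\<close>, then the imaginary part \<open>y dp\<close> of \<open>\<tau> dp + dq\<close> gives \<open>dp = 0\<close>, its
  real part then \<open>dq = 0\<close>, and finally \<open>\<lambda>\<^sub>6\<close> gives \<open>d\<kappa> = 0\<close>.
\<close>

lemma ext_metric_pos:
  assumes "\<alpha> > 0" "\<gamma> > 0" "\<delta> > 0" "m \<in> ext_SJ" "v \<noteq> 0"
  shows "ext_metric \<alpha> \<gamma> \<delta> m v v > 0"
proof -
  have y: "Im (tau m) > 0"
    using assms(4) by (simp add: mem_ext_SJ)
  let ?A = "\<alpha> / (Im (tau m))\<^sup>2 * (norm (tau v))\<^sup>2" and ?B = "\<gamma> / Im (tau m) * (norm (tau_dp_dq m v))\<^sup>2"
    and ?C = "(lambda6 \<delta> m v)\<^sup>2"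
  have eq: "ext_metric \<alpha> \<gamma> \<delta> m v v = ?A + ?B + ?C"
    unfolding ext_metric_eq complex_mult_cnj cmod_power2 Re_complex_of_real power2_eq_square[of "lambda6 _ _ _"] ..
  have nonneg: "?A \<ge> 0" "?B \<ge> 0" "?C \<ge> 0"
    using y assms by simp_all
  have "\<not> (?A = 0 \<and> ?B = 0 \<and> ?C = 0)"
  proof (rule notI, elim conjE)
    assume "?A = 0" "?B = 0" "?C = 0"
    then have z: "tau v = 0" "tau_dp_dq m v = 0" "lambda6 \<delta> m v = 0"
      using y assms by auto
    from z(2) have "p_of v = 0"
      using y by (auto simp: tau_dp_dq_def complex_eq_iff)
    moreover from this z(2) have "q_of v = 0"
      by (simp add: tau_dp_dq_def)
    ultimately have "kappa_of v = 0"
      using z(3) assms by (simp add: lambda6_eq)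
    then have "v = 0"
      using \<open>p_of v = 0\<close> \<open>q_of v = 0\<close> z(1) by (cases v) (auto simp: zero_prod_def complex_eq_iff)
    then show False
      using assms(5) by simp
  qed
  then show ?thesis
    using nonneg unfolding eq by linarith
qed

lemma smooth_on_ext_metric: "smooth_on ext_SJ (\<lambda>m. ext_metric \<alpha> \<gamma> \<delta> m u v)"
proof -
  let ?Re = "\<lambda>m. Re (tau m)" and ?i = "\<lambda>m. inverse (Im (tau m))"
  (* Differences and quotients are written as sums and products, to which the closure rules apply. *)
  have eq: "ext_metric \<alpha> \<gamma> \<delta> m u v =
      \<alpha> * Re (tau u * cnj (tau v)) * (?i m * ?i m)
      + \<gamma> * ?i m * ((p_of u * ?Re m + q_of u) * (p_of v * ?Re m + q_of v)
          + p_of u * Im (tau m) * (p_of v * Im (tau m)))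
      + (sqrt \<delta> * (kappa_of u + (-1) * p_of m * q_of u + q_of m * p_of u))
        * (sqrt \<delta> * (kappa_of v + (-1) * p_of m * q_of v + q_of m * p_of v))" for m
    by (simp add: ext_metric_eq tau_dp_dq_def lambda6_eq divide_inverse power2_eq_square)
  show ?thesis
    unfolding eq
    by (intro smooth_on_add smooth_on_mult smooth_on_const smooth_on_inverse open_ext_SJ
        smooth_on_bounded_linear bounded_linear_p_of bounded_linear_q_of
        bounded_linear_compose[OF bounded_linear_Re bounded_linear_tau]
        bounded_linear_compose[OF bounded_linear_Im bounded_linear_tau])
      (auto simp: mem_ext_SJ)
qed

lemma riemannian_metric_ext_metric:
  assumes "\<alpha> > 0" "\<gamma> > 0" "\<delta> > 0"
  shows "riemannian_metric ext_SJ (ext_metric \<alpha> \<gamma> \<delta>)"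
  unfolding riemannian_metric_def bilinear_def
proof (intro conjI ballI allI impI)
  fix m u v
  show "linear (ext_metric \<alpha> \<gamma> \<delta> m u)"
    by (rule linear_ext_metric)
  have "(\<lambda>u. ext_metric \<alpha> \<gamma> \<delta> m u v) = ext_metric \<alpha> \<gamma> \<delta> m v"
    using ext_metric_sym by blast
  then show "linear (\<lambda>u. ext_metric \<alpha> \<gamma> \<delta> m u v)"
    by (simp add: linear_ext_metric)
qed (use assms ext_metric_sym ext_metric_pos smooth_on_ext_metric in \<open>auto\<close>)

text \<open>
  On \<open>L\<^sup>1\<close> and \<open>L\<^sup>2\<close> only \<open>d\<tau>\<close> is nonzero, on \<open>L\<^sup>4\<close> and \<open>L\<^sup>5\<close> only \<open>\<tau> dp + dq\<close>, and on \<open>L\<^sup>6\<close> only \<open>\<lambda>\<^sub>6\<close>.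
  Within each of the first two pairs the values differ by the factor \<open>\<i>\<close>, which makes them orthogonal
  in the complex plane.
\<close>

lemma orthonormal_frame:
  assumes "\<alpha> > 0" "\<gamma> > 0" "\<delta> > 0"
  shows "orthonormal_fields ext_SJ (ext_metric \<alpha> \<gamma> \<delta>)
     [L1_0 \<alpha> \<theta>, L2_0 \<alpha> \<theta>, L4 \<gamma> \<theta>, L5 \<gamma> \<theta>, L6 \<delta>]"
proof -
  let ?Ls = "[L1_0 \<alpha> \<theta>, L2_0 \<alpha> \<theta>, L4 \<gamma> \<theta>, L5 \<gamma> \<theta>, L6 \<delta>]"
  have "ext_metric \<alpha> \<gamma> \<delta> m ((?Ls ! i) m) ((?Ls ! j) m) = (if i = j then 1 else 0)"
    if "m \<in> ext_SJ" "i < 5" "j < 5" for m i j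
  proof -
    obtain x y p q k where m: "m = (x, y, p, q, k)"
      by (cases m)
    have y: "y > 0"
      using that(1) by (simp add: m ext_SJ_def)
    (* Opaque names keep the simplifier from clearing the denominators in the two normalizations. *)
    define A B where "A = \<alpha> / y\<^sup>2" and "B = \<gamma> / y"
    define r s where "r = y / sqrt \<alpha>" and "s = y / sqrt (\<gamma> * y)"
    have r: "A * r\<^sup>2 = 1" and s: "B * s\<^sup>2 = 1"
      using assms y by (simp_all add: A_def B_def r_def s_def power_divide) (simp add: power2_eq_square)
    have t:
      "tau (L1_0 \<alpha> \<theta> m) = of_real r * cis (2 * \<theta>)" "tau_dp_dq m (L1_0 \<alpha> \<theta> m) = 0" "lambda6 \<delta> m (L1_0 \<alpha> \<theta> m) = 0"
      "tau (L2_0 \<alpha> \<theta> m) = of_real r * (\<i> * cis (2 * \<theta>))" "tau_dp_dq m (L2_0 \<alpha> \<theta> m) = 0" "lambda6 \<delta> m (L2_0 \<alpha> \<theta> m) = 0"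
      "tau (L4 \<gamma> \<theta> m) = 0" "tau_dp_dq m (L4 \<gamma> \<theta> m) = of_real s * (\<i> * cis \<theta>)" "lambda6 \<delta> m (L4 \<gamma> \<theta> m) = 0"
      "tau (L5 \<gamma> \<theta> m) = 0" "tau_dp_dq m (L5 \<gamma> \<theta> m) = of_real s * cis \<theta>" "lambda6 \<delta> m (L5 \<gamma> \<theta> m) = 0"
      "tau (L6 \<delta> m) = 0" "tau_dp_dq m (L6 \<delta> m) = 0" "lambda6 \<delta> m (L6 \<delta> m) = 1"
      using assms(3)
      by (simp_all add: m tau_dp_dq_def r_def s_def complex_eq_iff lambda6_eq cis.ctr add_divide_distrib
          diff_divide_distrib algebra_simps)
    have c: "Re (of_real a * cis b * cnj (of_real a * cis b)) = a\<^sup>2"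
      "Re (of_real a * (\<i> * cis b) * cnj (of_real a * (\<i> * cis b))) = a\<^sup>2"
      "Re (of_real a * cis b * cnj (of_real a * (\<i> * cis b))) = 0"
      "Re (of_real a * (\<i> * cis b) * cnj (of_real a * cis b)) = 0" for a b
      by (simp_all only: complex_norm_square[symmetric] Re_complex_of_real norm_mult)
        (simp_all add: algebra_simps)
    have g: "ext_metric \<alpha> \<gamma> \<delta> m u v = A * Re (tau u * cnj (tau v))
        + B * Re (tau_dp_dq m u * cnj (tau_dp_dq m v)) + lambda6 \<delta> m u * lambda6 \<delta> m v" for u v
      unfolding ext_metric_eq A_def B_def by (simp add: m)
    have "i = 0 \<or> i = 1 \<or> i = 2 \<or> i = 3 \<or> i = 4" "j = 0 \<or> j = 1 \<or> j = 2 \<or> j = 3 \<or> j = 4"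
      using that(2,3) by linarith+
    then show ?thesis
      by (elim disjE) (simp_all add: g t c r s del: complex_cnj_mult times_complex.simps)
  qed
  then show ?thesis
    by (auto simp: orthonormal_fields_def)
qed

section \<open>Invariance under the Jacobi group\<close>

lemma vector_matrix_mult_2:
  fixes w :: "real^2" and A :: "real^2^2"
  shows "w v* A = vector [w$1 * A$1$1 + w$2 * A$2$1, w$1 * A$1$2 + w$2 * A$2$2]"
  by (simp add: vec_eq_iff forall_2 vector_matrix_mult_def sum_2 mult.commute)

lemma matrix_inv_SL2:
  fixes M :: "real^2^2"
  assumes "det M = 1"
  shows "matrix_inv M = vector [vector [M$2$2, - M$1$2], vector [- M$2$1, M$1$1]]"
proof -
  let ?B = "vector [vector [M$2$2, - M$1$2], vector [- M$2$1, M$1$1]] :: real^2^2"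
  have B: "M ** ?B = mat 1" "?B ** M = mat 1"
    using assms by (simp_all add: vec_eq_iff forall_2 matrix_matrix_mult_def sum_2 mat_def det_2 algebra_simps)
  then have "\<exists>A'. M ** A' = mat 1 \<and> A' ** M = mat 1"
    by (intro exI conjI)
  from someI_ex[OF this] have "M ** matrix_inv M = mat 1 \<and> matrix_inv M ** M = mat 1"
    by (simp only: matrix_inv_def)
  then have inv: "matrix_inv M ** M = mat 1" ..
  have "matrix_inv M = matrix_inv M ** (M ** ?B)"
    by (simp only: B matrix_mul_rid)
  also have "\<dots> = ?B"
    by (simp only: matrix_mul_assoc inv matrix_mul_lid)
  finally show ?thesis .
qed

definition frac_linear :: "real^2^2 \<Rightarrow> complex \<Rightarrow> complex" where
  "frac_linear M z = (of_real (M$1$1) * z + of_real (M$1$2)) / (of_real (M$2$1) * z + of_real (M$2$2))"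

definition automorphy :: "real^2^2 \<Rightarrow> complex \<Rightarrow> complex" where
  "automorphy M z = of_real (M$2$1) * z + of_real (M$2$2)"

lemma jac_act_SL2:
  assumes "det M = 1"
  shows "jac_act (M, X, \<kappa>) m =
    (Re (frac_linear M (tau m)), Im (frac_linear M (tau m)),
     (X$1 + p_of m) * M$2$2 - (X$2 + q_of m) * M$2$1,
     (X$2 + q_of m) * M$1$1 - (X$1 + p_of m) * M$1$2,
     \<kappa> + kappa_of m + X$1 * q_of m - X$2 * p_of m)"
  by (cases m) (simp add: jac_act_def Let_def matrix_inv_SL2[OF assms] vector_matrix_mult_2
      frac_linear_def algebra_simps)

lemma automorphy_nonzero:
  assumes "det M = 1" "Im z > 0"
  shows "automorphy M z \<noteq> 0"
proof
  assume "automorphy M z = 0"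
  then have "M$2$1 * Im z = 0" "M$2$1 * Re z + M$2$2 = 0"
    by (simp_all add: automorphy_def complex_eq_iff)
  then show False
    using assms by (auto simp: det_2)
qed

lemma Im_frac_linear:
  assumes "det M = 1" "Im z > 0"
  shows "Im (frac_linear M z) = Im z / (norm (automorphy M z))\<^sup>2"
proof -
  have "Im (frac_linear M z) = ((M$1$1 * M$2$2 - M$1$2 * M$2$1) * Im z) / (norm (automorphy M z))\<^sup>2"
    unfolding frac_linear_def automorphy_def[symmetric] Im_divide cmod_power2
    by (simp add: automorphy_def algebra_simps)
  then show ?thesis
    using assms by (simp add: det_2)
qed

lemma has_derivative_frac_linear:
  assumes "det M = 1" "Im z > 0"
  shows "(frac_linear M has_field_derivative 1 / (automorphy M z)\<^sup>2) (at z)"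
proof -
  have d: "of_real (M$1$1) * of_real (M$2$2) - of_real (M$1$2) * of_real (M$2$1) = (1::complex)"
    using assms(1) by (simp add: det_2 flip: of_real_mult of_real_diff)
  have "(frac_linear M has_field_derivative
      (of_real (M$1$1) * automorphy M z - (of_real (M$1$1) * z + of_real (M$1$2)) * of_real (M$2$1))
        / (automorphy M z * automorphy M z)) (at z)"
    unfolding frac_linear_def[abs_def]
    using automorphy_nonzero[OF assms] by (auto intro!: derivative_eq_intros simp: automorphy_def)
  moreover have "of_real (M$1$1) * automorphy M z - (of_real (M$1$1) * z + of_real (M$1$2)) * of_real (M$2$1) = 1"
    using d unfolding automorphy_def by algebra
  ultimately show ?thesis
    by (simp add: power2_eq_square)
qed

text \<open>
  The differential of the action of a group element. Its first two components are multiplication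
  by the complex derivative \<open>1 / (c \<tau> + d)\<^sup>2\<close> of the fractional linear map.
\<close>

definition jac_tangent :: "jac \<Rightarrow> pt5 \<Rightarrow> pt5 \<Rightarrow> pt5" where
  "jac_tangent = (\<lambda>(M, X, \<kappa>) m u.
     (Re (tau u / (automorphy M (tau m))\<^sup>2), Im (tau u / (automorphy M (tau m))\<^sup>2),
      p_of u * M$2$2 - q_of u * M$2$1, q_of u * M$1$1 - p_of u * M$1$2,
      kappa_of u + X$1 * q_of u - X$2 * p_of u))"

lemma has_derivative_jac_act:
  assumes "det M = 1" "m \<in> ext_SJ"
  shows "(jac_act (M, X, \<kappa>) has_derivative jac_tangent (M, X, \<kappa>) m) (at m)"
proof -
  note lin = bounded_linear_imp_has_derivative[OF bounded_linear_p_of]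
    bounded_linear_imp_has_derivative[OF bounded_linear_q_of]
    bounded_linear_imp_has_derivative[OF bounded_linear_kappa_of]
  have "(frac_linear M has_derivative (*) (1 / (automorphy M (tau m))\<^sup>2)) (at (tau m))"
    using has_derivative_frac_linear[OF assms(1)] assms(2)
    by (simp only: has_field_derivative_def mem_ext_SJ)
  from has_derivative_compose[OF bounded_linear_imp_has_derivative[OF bounded_linear_tau] this]
  have z: "((\<lambda>m. frac_linear M (tau m)) has_derivative (\<lambda>u. tau u / (automorphy M (tau m))\<^sup>2)) (at m)"
    by simp
  show ?thesis
    unfolding jac_act_SL2[OF assms(1), abs_def] jac_tangent_def prod.case
    by (intro has_derivative_Pair has_derivative_Re has_derivative_Im z)
      (auto intro!: derivative_eq_intros lin)
qed

text \<open>
  After multiplication by \<open>c \<tau> + d\<close> the left-hand side becomes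
  \<open>(d dp - c dq) (a \<tau> + b) + (a dq - b dp) (c \<tau> + d)\<close>, in which all but the terms with the factor
  \<open>a d - b c\<close> cancel.
\<close>

lemma tau_dp_dq_jac_act:
  assumes "det M = 1" "m \<in> ext_SJ"
  shows "tau_dp_dq (jac_act (M, X, \<kappa>) m) (jac_tangent (M, X, \<kappa>) m u) = tau_dp_dq m u / automorphy M (tau m)"
proof -
  have d: "of_real (M$1$1) * of_real (M$2$2) - of_real (M$1$2) * of_real (M$2$1) = (1::complex)"
    using assms(1) by (simp add: det_2 flip: of_real_mult of_real_diff)
  have j: "automorphy M (tau m) \<noteq> 0"
    using automorphy_nonzero assms by (simp add: mem_ext_SJ)
  have E: "(of_real (p_of u) * of_real (M$2$2) - of_real (q_of u) * of_real (M$2$1)) *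
        (of_real (M$1$1) * tau m + of_real (M$1$2))
      + (of_real (q_of u) * of_real (M$1$1) - of_real (p_of u) * of_real (M$1$2)) * automorphy M (tau m)
      = tau_dp_dq m u"
    using d unfolding automorphy_def tau_dp_dq_def by algebra
  have quot: "(A * w + B * automorphy M (tau m)) / automorphy M (tau m) =
      A * (w / automorphy M (tau m)) + B" for A w B
    using j by (simp add: add_divide_distrib)
  have "tau_dp_dq m u / automorphy M (tau m) =
      (of_real (p_of u) * of_real (M$2$2) - of_real (q_of u) * of_real (M$2$1)) * frac_linear M (tau m)
      + (of_real (q_of u) * of_real (M$1$1) - of_real (p_of u) * of_real (M$1$2))"
    by (simp only: frac_linear_def automorphy_def[symmetric] quot flip: E)
  then show ?thesis
    by (simp add: tau_dp_dq_def jac_act_SL2[OF assms(1)] jac_tangent_def)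
qed

text \<open>
  The pairing \<open>p dq - q dp\<close> at the translated point \<open>(\<lambda> + p, \<mu> + q)\<close> is unchanged by the matrix and
  exceeds the one at \<open>(p, q)\<close> by \<open>\<lambda> dq - \<mu> dp\<close>, which is exactly what the differential of the new
  \<open>\<kappa>\<close>-coordinate adds to \<open>d\<kappa>\<close>.
\<close>

lemma lambda6_jac_act:
  assumes "det M = 1"
  shows "lambda6 \<delta> (jac_act (M, X, \<kappa>) m) (jac_tangent (M, X, \<kappa>) m u) = lambda6 \<delta> m u"
proof -
  have "M$1$1 * M$2$2 - M$1$2 * M$2$1 = 1"
    using assms by (simp add: det_2)
  then have "kappa_of u + X$1 * q_of u - X$2 * p_of u
      - ((X$1 + p_of m) * M$2$2 - (X$2 + q_of m) * M$2$1) * (q_of u * M$1$1 - p_of u * M$1$2)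
      + ((X$2 + q_of m) * M$1$1 - (X$1 + p_of m) * M$1$2) * (p_of u * M$2$2 - q_of u * M$2$1)
      = kappa_of u - p_of m * q_of u + q_of m * p_of u"
    by algebra
  then show ?thesis
    by (simp add: lambda6_eq jac_act_SL2[OF assms] jac_tangent_def)
qed

lemma Re_divide_cnj_divide: "Re (z / w * cnj (z' / w)) = Re (z * cnj z') / (norm w)\<^sup>2"
proof -
  have "z / w * cnj (z' / w) = z * cnj z' / of_real ((norm w)\<^sup>2)"
    by (simp only: complex_norm_square complex_cnj_divide times_divide_times_eq)
  then show ?thesis
    by (simp only: Re_divide_of_real)
qed

lemma invariant_ext_metric:
  "invariant_metric (carrier jacobi_group) jac_act ext_SJ (ext_metric \<alpha> \<gamma> \<delta>)"
  unfolding invariant_metric_def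
proof (intro ballI conjI exI allI)
  fix h m u v
  assume "h \<in> carrier jacobi_group" and m: "m \<in> ext_SJ"
  then obtain M X \<kappa> where h: "h = (M, X, \<kappa>)" and det: "det M = 1"
    by (auto simp: jacobi_group_def)
  have y: "Im (tau m) > 0"
    using m by (simp add: mem_ext_SJ)
  define N where "N = (norm (automorphy M (tau m)))\<^sup>2"
  have N: "N > 0"
    using automorphy_nonzero[OF det y] by (simp add: N_def)
  have Im: "Im (tau (jac_act h m)) = Im (tau m) / N"
    by (simp add: h jac_act_SL2[OF det] Im_frac_linear[OF det y] N_def)
  then show "jac_act h m \<in> ext_SJ"
    using y N by (simp add: mem_ext_SJ)
  show "(jac_act h has_derivative jac_tangent h m) (at m)"
    unfolding h by (rule has_derivative_jac_act[OF det m])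
  have tau: "tau (jac_tangent h m w) = tau w / (automorphy M (tau m))\<^sup>2" for w
    by (simp add: h jac_tangent_def)
  have "(norm ((automorphy M (tau m))\<^sup>2))\<^sup>2 = N\<^sup>2"
    by (simp add: N_def norm_power)
  then show "ext_metric \<alpha> \<gamma> \<delta> (jac_act h m) (jac_tangent h m u) (jac_tangent h m v) = ext_metric \<alpha> \<gamma> \<delta> m u v"
    unfolding ext_metric_eq Im tau Re_divide_cnj_divide
    unfolding h tau_dp_dq_jac_act[OF det m] lambda6_jac_act[OF det] Re_divide_cnj_divide N_def[symmetric]
    using N y by (simp add: power_divide)
qed

section \<open>Fundamental vector fields\<close>

text \<open>
  The first two coordinates of an orbit are differentiated together, as one complex function of the
  time.
\<close>

lemma has_vector_derivative_pt5:
  assumes "(z has_vector_derivative z') (at t)" "(p has_vector_derivative p') (at t)"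
    "(q has_vector_derivative q') (at t)" "(k has_vector_derivative k') (at t)"
  shows "((\<lambda>t. (Re (z t), Im (z t), p t, q t, k t)) has_vector_derivative (Re z', Im z', p', q', k')) (at t)"
  by (intro has_vector_derivative_Pair assms bounded_linear.has_vector_derivative[OF bounded_linear_Re]
      bounded_linear.has_vector_derivative[OF bounded_linear_Im])

lemma fundamental_vector_field_F:
  "fundamental_vector_field jac_act ext_SJ exp_F (\<lambda>(x, y, p, q, \<kappa>). (1, 0, 0, - p, 0))"
  unfolding fundamental_vector_field_def
proof
  fix m :: pt5 assume "m \<in> ext_SJ"
  have eq: "(\<lambda>t. jac_act (exp_F t) m) =
      (\<lambda>t. (Re (tau m + of_real t), Im (tau m + of_real t), p_of m, q_of m - p_of m * t, kappa_of m))"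
    by (rule ext) (simp add: exp_F_def jac_act_SL2 det_2 frac_linear_def)
  have "((\<lambda>t. jac_act (exp_F t) m) has_vector_derivative (Re 1, Im 1, 0, - p_of m, 0)) (at 0)"
    unfolding eq by (rule has_vector_derivative_pt5) (auto intro!: derivative_eq_intros)
  then show "((\<lambda>t. jac_act (exp_F t) m) has_vector_derivative
      (case m of (x, y, p, q, \<kappa>) \<Rightarrow> (1, 0, 0, - p, 0))) (at 0)"
    by (cases m) simp
qed

lemma fundamental_vector_field_G:
  "fundamental_vector_field jac_act ext_SJ exp_G
     (\<lambda>(x, y, p, q, \<kappa>). (y\<^sup>2 - x\<^sup>2, - 2 * x * y, - q, 0, 0))"
  unfolding fundamental_vector_field_def
proof
  fix m :: pt5 assume "m \<in> ext_SJ"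
  have eq: "(\<lambda>t. jac_act (exp_G t) m) =
      (\<lambda>t. (Re (tau m / (of_real t * tau m + 1)), Im (tau m / (of_real t * tau m + 1)),
         p_of m - q_of m * t, q_of m, kappa_of m))"
    by (rule ext) (simp add: exp_G_def jac_act_SL2 det_2 frac_linear_def)
  have z: "((\<lambda>t. tau m / (of_real t * tau m + 1)) has_vector_derivative - (tau m)\<^sup>2) (at 0)"
    by (rule has_vector_derivative_real_field)
      (auto intro!: derivative_eq_intros simp: power2_eq_square)
  have "((\<lambda>t. jac_act (exp_G t) m) has_vector_derivative
      (Re (- (tau m)\<^sup>2), Im (- (tau m)\<^sup>2), - q_of m, 0, 0)) (at 0)"
    unfolding eq by (rule has_vector_derivative_pt5[OF z]) (auto intro!: derivative_eq_intros)
  then show "((\<lambda>t. jac_act (exp_G t) m) has_vector_derivative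
      (case m of (x, y, p, q, \<kappa>) \<Rightarrow> (y\<^sup>2 - x\<^sup>2, - 2 * x * y, - q, 0, 0))) (at 0)"
    by (cases m) (simp add: power2_eq_square mult.assoc)
qed

lemma fundamental_vector_field_H:
  "fundamental_vector_field jac_act ext_SJ exp_H
     (\<lambda>(x, y, p, q, \<kappa>). (2 * x, 2 * y, - p, q, 0))"
  unfolding fundamental_vector_field_def
proof
  fix m :: pt5 assume "m \<in> ext_SJ"
  have eq: "(\<lambda>t. jac_act (exp_H t) m) =
      (\<lambda>t. (Re (exp (2 * of_real t) * tau m), Im (exp (2 * of_real t) * tau m),
         p_of m * exp (- t), q_of m * exp t, kappa_of m))"
  proof
    fix t :: real
    have "frac_linear (vector [vector [exp t, 0], vector [0, exp (- t)]]) (tau m) =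
        exp (2 * of_real t) * tau m"
      unfolding mult_2 exp_add by (simp add: frac_linear_def exp_minus field_simps flip: exp_of_real)
    then show "jac_act (exp_H t) m = (Re (exp (2 * of_real t) * tau m), Im (exp (2 * of_real t) * tau m),
         p_of m * exp (- t), q_of m * exp t, kappa_of m)"
      by (simp add: exp_H_def jac_act_SL2 det_2 flip: exp_add)
  qed
  have z: "((\<lambda>t. exp (2 * of_real t) * tau m) has_vector_derivative 2 * tau m) (at 0)"
    by (rule has_vector_derivative_real_field) (auto intro!: derivative_eq_intros)
  have "((\<lambda>t. jac_act (exp_H t) m) has_vector_derivative
      (Re (2 * tau m), Im (2 * tau m), - p_of m, q_of m, 0)) (at 0)"
    unfolding eq
    by (rule has_vector_derivative_pt5[OF z])
      (auto intro!: derivative_eq_intros simp flip: has_real_derivative_iff_has_vector_derivative)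
  then show "((\<lambda>t. jac_act (exp_H t) m) has_vector_derivative
      (case m of (x, y, p, q, \<kappa>) \<Rightarrow> (2 * x, 2 * y, - p, q, 0))) (at 0)"
    by (cases m) simp
qed

lemma jac_act_Heisenberg:
  "jac_act (mat 1, X, \<kappa>) m =
     (Re (tau m), Im (tau m), X$1 + p_of m, X$2 + q_of m, \<kappa> + kappa_of m + X$1 * q_of m - X$2 * p_of m)"
proof -
  have "(mat 1 :: real^2^2)$1$1 = 1" "(mat 1 :: real^2^2)$1$2 = 0"
    "(mat 1 :: real^2^2)$2$1 = 0" "(mat 1 :: real^2^2)$2$2 = 1"
    by (simp_all add: mat_def)
  then show ?thesis
    by (simp add: jac_act_SL2[OF det_I] frac_linear_def)
qed

lemma fundamental_vector_field_P:
  "fundamental_vector_field jac_act ext_SJ exp_P (\<lambda>(x, y, p, q, \<kappa>). (0, 0, 1, 0, q))"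
  unfolding fundamental_vector_field_def
proof
  fix m :: pt5 assume "m \<in> ext_SJ"
  have "((\<lambda>t. jac_act (exp_P t) m) has_vector_derivative (Re 0, Im 0, 1, 0, q_of m)) (at 0)"
    unfolding exp_P_def jac_act_Heisenberg
    by (rule has_vector_derivative_pt5) (auto intro!: derivative_eq_intros)
  then show "((\<lambda>t. jac_act (exp_P t) m) has_vector_derivative
      (case m of (x, y, p, q, \<kappa>) \<Rightarrow> (0, 0, 1, 0, q))) (at 0)"
    by (cases m) simp
qed

lemma fundamental_vector_field_Q:
  "fundamental_vector_field jac_act ext_SJ exp_Q (\<lambda>(x, y, p, q, \<kappa>). (0, 0, 0, 1, - p))"
  unfolding fundamental_vector_field_def
proof
  fix m :: pt5 assume "m \<in> ext_SJ"
  have "((\<lambda>t. jac_act (exp_Q t) m) has_vector_derivative (Re 0, Im 0, 0, 1, - p_of m)) (at 0)"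
    unfolding exp_Q_def jac_act_Heisenberg
    by (rule has_vector_derivative_pt5) (auto intro!: derivative_eq_intros)
  then show "((\<lambda>t. jac_act (exp_Q t) m) has_vector_derivative
      (case m of (x, y, p, q, \<kappa>) \<Rightarrow> (0, 0, 0, 1, - p))) (at 0)"
    by (cases m) simp
qed

lemma fundamental_vector_field_R:
  "fundamental_vector_field jac_act ext_SJ exp_R (\<lambda>(x, y, p, q, \<kappa>). (0, 0, 0, 0, 1))"
  unfolding fundamental_vector_field_def
proof
  fix m :: pt5 assume "m \<in> ext_SJ"
  have "((\<lambda>t. jac_act (exp_R t) m) has_vector_derivative (Re 0, Im 0, 0, 0, 1)) (at 0)"
    unfolding exp_R_def jac_act_Heisenberg
    by (rule has_vector_derivative_pt5) (auto intro!: derivative_eq_intros)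
  then show "((\<lambda>t. jac_act (exp_R t) m) has_vector_derivative
      (case m of (x, y, p, q, \<kappa>) \<Rightarrow> (0, 0, 0, 0, 1))) (at 0)"
    by (cases m) simp
qed

section \<open>The exterior derivative of \<open>\<lambda>\<^sub>6\<close>\<close>

text \<open>
  The coefficients of \<open>\<lambda>\<^sub>6\<close> depend only on \<open>p\<close> and \<open>q\<close>, and its exterior derivative is
  \<open>2 \<surd>\<delta> dq \<and> dp\<close>. Openness of the domain matters: the derivative of \<open>\<eta>\<close> at a point sees \<open>\<eta>\<close> nearby,
  where it is prescribed only inside the domain.
\<close>

lemma ext_deriv_lambda6:
  assumes "\<And>m. m \<in> ext_SJ \<Longrightarrow> \<eta> m = lambda6 \<delta> m" and m: "m \<in> ext_SJ"
  shows "ext_deriv \<eta> m u v = (2 * sqrt \<delta> * q_of u) * p_of v - (2 * sqrt \<delta> * q_of v) * p_of u"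
proof -
  have D: "((\<lambda>n. \<eta> n w) has_derivative (\<lambda>d. sqrt \<delta> * (q_of d * p_of w - p_of d * q_of w))) (at m)" for w
  proof (rule has_derivative_transform_within_open[OF _ open_ext_SJ m])
    show "((\<lambda>n. lambda6 \<delta> n w) has_derivative (\<lambda>d. sqrt \<delta> * (q_of d * p_of w - p_of d * q_of w))) (at m)"
      unfolding lambda6_eq
      by (auto intro!: derivative_eq_intros bounded_linear_imp_has_derivative[OF bounded_linear_p_of]
          bounded_linear_imp_has_derivative[OF bounded_linear_q_of])
  qed (simp add: assms(1))
  have "frechet_derivative (\<lambda>n. \<eta> n w) (at m) = (\<lambda>d. sqrt \<delta> * (q_of d * p_of w - p_of d * q_of w))" for w
    using frechet_derivative_at[OF D[of w]] by simp
  then show ?thesis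
    by (simp add: ext_deriv_def algebra_simps)
qed

lemma not_contact_form_lambda6:
  assumes "\<And>m. m \<in> ext_SJ \<Longrightarrow> \<eta> m = lambda6 \<delta> m"
  shows "\<not> contact_form ext_SJ \<eta>"
proof (rule not_contact_form_if_decomposable)
  show "(0, 1, 0, 0, 0) \<in> ext_SJ"
    by (simp add: ext_SJ_def)
  then show "ext_deriv \<eta> (0, 1, 0, 0, 0) u v =
      (2 * sqrt \<delta> * q_of u) * p_of v - (2 * sqrt \<delta> * q_of v) * p_of u" for u v
    using ext_deriv_lambda6[OF assms] by blast
qed simp

theorem proposition5p6:
  fixes \<alpha> \<gamma> \<delta> \<theta> :: real
  assumes "\<alpha> > 0" and "\<gamma> > 0" and "\<delta> > 0"
  shows
    "riemannian_metric ext_SJ (ext_metric \<alpha> \<gamma> \<delta>) \<and>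
     (\<forall>x y p q \<kappa> dx dy dp dq d\<kappa>. y > 0 \<longrightarrow>
        ext_metric \<alpha> \<gamma> \<delta> (x, y, p, q, \<kappa>) (dx, dy, dp, dq, d\<kappa>) (dx, dy, dp, dq, d\<kappa>) =
          \<alpha> / y\<^sup>2 * (dx\<^sup>2 + dy\<^sup>2)
          + (\<gamma> / y * (x\<^sup>2 + y\<^sup>2) + \<delta> * q\<^sup>2) * dp\<^sup>2
          + (\<gamma> / y + \<delta> * p\<^sup>2) * dq\<^sup>2
          + \<delta> * d\<kappa>\<^sup>2
          + 2 * (\<gamma> * (x / y) - \<delta> * p * q) * dp * dq
          + 2 * \<delta> * (q * dp * d\<kappa> - p * dq * d\<kappa>)) \<and>
     invariant_metric (carrier jacobi_group) jac_act ext_SJ (ext_metric \<alpha> \<gamma> \<delta>) \<and>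
     (\<forall>x y p q \<kappa>. y > 0 \<longrightarrow>
        metric_matrix (ext_metric \<alpha> \<gamma> \<delta> (x, y, p, q, \<kappa>)) =
          (let gxx = \<alpha> / y\<^sup>2; gyy = \<alpha> / y\<^sup>2;
               gpp = \<gamma> * ((x\<^sup>2 + y\<^sup>2) / y) + \<delta> * q\<^sup>2;
               gqq = \<gamma> / y + \<delta> * p\<^sup>2;
               gpq = \<gamma> * (x / y) - \<delta> * p * q;
               gp\<kappa> = \<delta> * q; gq\<kappa> = - \<delta> * p; g\<kappa>\<kappa> = \<delta>
           in [[gxx, 0, 0, 0, 0],
               [0, gyy, 0, 0, 0],
               [0, 0, gpp, gpq, gp\<kappa>],
               [0, 0, gpq, gqq, gq\<kappa>],
               [0, 0, gp\<kappa>, gq\<kappa>, g\<kappa>\<kappa>]])) \<and>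
     orthonormal_fields ext_SJ (ext_metric \<alpha> \<gamma> \<delta>)
       [L1_0 \<alpha> \<theta>, L2_0 \<alpha> \<theta>, L4 \<gamma> \<theta>, L5 \<gamma> \<theta>, L6 \<delta>] \<and>
     fundamental_vector_field jac_act ext_SJ exp_F (\<lambda>(x, y, p, q, \<kappa>). (1, 0, 0, - p, 0)) \<and>
     fundamental_vector_field jac_act ext_SJ exp_G
       (\<lambda>(x, y, p, q, \<kappa>). (y\<^sup>2 - x\<^sup>2, - 2 * x * y, - q, 0, 0)) \<and>
     fundamental_vector_field jac_act ext_SJ exp_H
       (\<lambda>(x, y, p, q, \<kappa>). (2 * x, 2 * y, - p, q, 0)) \<and>
     fundamental_vector_field jac_act ext_SJ exp_P (\<lambda>(x, y, p, q, \<kappa>). (0, 0, 1, 0, q)) \<and>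
     fundamental_vector_field jac_act ext_SJ exp_Q (\<lambda>(x, y, p, q, \<kappa>). (0, 0, 0, 1, - p)) \<and>
     fundamental_vector_field jac_act ext_SJ exp_R (\<lambda>(x, y, p, q, \<kappa>). (0, 0, 0, 0, 1)) \<and>
     \<not> (\<exists>\<Phi> \<xi> \<eta>. (\<forall>m\<in>ext_SJ. \<eta> m = lambda6 \<delta> m) \<and>
          almost_contact_structure ext_SJ \<Phi> \<xi> \<eta> \<and>
          contact_form ext_SJ \<eta> \<and> reeb_vector_field ext_SJ \<eta> \<xi>)"
proof (intro conjI)
  have sqrt: "sqrt \<delta> * a * (sqrt \<delta> * b) = \<delta> * (a * b)" for a b
  proof -
    have "sqrt \<delta> * a * (sqrt \<delta> * b) = (sqrt \<delta> * sqrt \<delta>) * (a * b)" by (simp only: ac_simps)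
    then show ?thesis using assms(3) by simp
  qed
  show "\<forall>x y p q \<kappa> dx dy dp dq d\<kappa>. y > 0 \<longrightarrow>
        ext_metric \<alpha> \<gamma> \<delta> (x, y, p, q, \<kappa>) (dx, dy, dp, dq, d\<kappa>) (dx, dy, dp, dq, d\<kappa>) =
          \<alpha> / y\<^sup>2 * (dx\<^sup>2 + dy\<^sup>2)
          + (\<gamma> / y * (x\<^sup>2 + y\<^sup>2) + \<delta> * q\<^sup>2) * dp\<^sup>2
          + (\<gamma> / y + \<delta> * p\<^sup>2) * dq\<^sup>2
          + \<delta> * d\<kappa>\<^sup>2
          + 2 * (\<gamma> * (x / y) - \<delta> * p * q) * dp * dq
          + 2 * \<delta> * (q * dp * d\<kappa> - p * dq * d\<kappa>)"
    by (simp add: sqrt divide_inverse power2_eq_square) (simp add: algebra_simps)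
  show "\<forall>x y p q \<kappa>. y > 0 \<longrightarrow>
        metric_matrix (ext_metric \<alpha> \<gamma> \<delta> (x, y, p, q, \<kappa>)) =
          (let gxx = \<alpha> / y\<^sup>2; gyy = \<alpha> / y\<^sup>2;
               gpp = \<gamma> * ((x\<^sup>2 + y\<^sup>2) / y) + \<delta> * q\<^sup>2;
               gqq = \<gamma> / y + \<delta> * p\<^sup>2;
               gpq = \<gamma> * (x / y) - \<delta> * p * q;
               gp\<kappa> = \<delta> * q; gq\<kappa> = - \<delta> * p; g\<kappa>\<kappa> = \<delta>
           in [[gxx, 0, 0, 0, 0],
               [0, gyy, 0, 0, 0],
               [0, 0, gpp, gpq, gp\<kappa>],
               [0, 0, gpq, gqq, gq\<kappa>],
               [0, 0, gp\<kappa>, gq\<kappa>, g\<kappa>\<kappa>]])"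
    using assms(3) by (simp add: metric_matrix_def coord_fields_def Let_def sqrt power2_eq_square ac_simps)
  show "\<not> (\<exists>\<Phi> \<xi> \<eta>. (\<forall>m\<in>ext_SJ. \<eta> m = lambda6 \<delta> m) \<and>
          almost_contact_structure ext_SJ \<Phi> \<xi> \<eta> \<and>
          contact_form ext_SJ \<eta> \<and> reeb_vector_field ext_SJ \<eta> \<xi>)"
    using not_contact_form_lambda6 by blast
qed (intro riemannian_metric_ext_metric invariant_ext_metric orthonormal_frame assms
    fundamental_vector_field_F fundamental_vector_field_G fundamental_vector_field_H
    fundamental_vector_field_P fundamental_vector_field_Q fundamental_vector_field_R)+

end
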